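(* Let $\alpha\in(0,2)$, $\mu\in(0,1)$ and $m>0$. Let $E\subset F\subset B_{1/2}\times\mathbb R$ be measurable sets satisfying the following two assumptions. (1) For every point $(x,t)\in F$ there exists a cylinder $Q\subset B_1\times\mathbb R$ such that $(x,t)\in Q$ and $|E\cap Q|\le(1-\mu)|Q|$. (2) For every cylinder $Q\subset B_1\times\mathbb R$ such that $|E\cap Q|>(1-\mu)|Q|$, one has $\bar Q^m\subset F$. Then $$|E|\le\frac{m+1}{m}(1-c\mu)|F|,$$ where $c>0$ is an absolute constant depending only on the dimension $d$.
   Context: $B_r(x)$ is the open ball in $\mathbb R^d$, $B_r=B_r(0)$. "Cylinder" means a parabolic cylinder $Q=Q_r(x,t)=B_r(x)\times(t-r^\alpha,t]$ with $r>0$, $(x,t)\in\mathbb R^d\times\mathbb R$. For such $Q$ and $m>0$, $\bar Q^m=B_r(x)\times(t,t+mr^\alpha)$ (a time-shifted, time-enlarged cylinder starting where $Q$ ends). $|\cdot|$ is Lebesgue measure on $\mathbb R^{d+1}$. *)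

theory Defs
  imports "HOL-Analysis.Analysis"
begin

definition cyl :: "real \<Rightarrow> real \<Rightarrow> real ^ 'd \<Rightarrow> real \<Rightarrow> ((real ^ 'd) \<times> real) set" where
  "cyl \<alpha> r x t = ball x r \<times> {t - r powr \<alpha> <.. t}"

text \<open>The shifted cylinder is open in time and starts where \<^term>\<open>cyl \<alpha> r x t\<close> ends.\<close>

definition stacked_cyl ::
    "real \<Rightarrow> real \<Rightarrow> real \<Rightarrow> real ^ 'd \<Rightarrow> real \<Rightarrow> ((real ^ 'd) \<times> real) set" where
  "stacked_cyl \<alpha> m r x t = ball x r \<times> {t <..< t + m * r powr \<alpha>}"

end

theory Submission
  imports Defs
begin

(* Call a cylinder heavy if E fills more than the fraction 1 - mu of it.  Shrinking the sparse cylinder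
   around a point p of E towards p, either one meets arbitrarily small sparse cylinders (only for a null
   set of p, by a Vitali covering inside an open set that barely exceeds E), or one meets a heavy
   cylinder whose density is still at most 1 - mu/2.  A Vitali covering by the latter gives
   mu |E| <= C |G - E| for the union G of all heavy cylinders, enlarged in time up to the top of their
   stacked cylinders.  By Fubini and an interval argument on the time slices, |G| is at most
   (m+1)/m times the measure of the union of the stacked cylinders, and that union lies in F. *)

section \<open>Comparison of unions, Vitali selection, and intervals on the line\<close>

text \<open>The \<open>X i\<close> may overlap, so they are summed by subadditivity, while the
  disjoint \<open>Y i\<close> are summed exactly. This carries a bound for each member over to the
  unions.\<close>

lemma emeasure_UN_le_of_disjoint:
  assumes "countable I"
    and X: "\<And>i. i \<in> I \<Longrightarrow> X i \<in> sets M"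
    and Y: "\<And>i. i \<in> I \<Longrightarrow> Y i \<in> sets M"
    and disj: "disjoint_family_on Y I"
    and le: "\<And>i. i \<in> I \<Longrightarrow> emeasure M (X i) \<le> K * emeasure M (Y i)"
  shows "emeasure M (\<Union>i\<in>I. X i) \<le> K * emeasure M (\<Union>i\<in>I. Y i)"
proof -
  define g where "g = to_nat_on I"
  have inj: "inj_on g I"
    using assms(1) by (simp add: g_def inj_on_to_nat_on)
  define X' where "X' n = (\<Union>i\<in>{i\<in>I. g i = n}. X i)" for n
  define Y' where "Y' n = (\<Union>i\<in>{i\<in>I. g i = n}. Y i)" for n
  have fibre: "(\<exists>i\<in>I. {i\<in>I. g i = n} = {i}) \<or> {i\<in>I. g i = n} = {}" for n
  proof (cases "n \<in> g ` I")
    case True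
    then obtain i where "i \<in> I" "n = g i" by blast
    then have "{i\<in>I. g i = n} = {i}"
      using inj by (auto simp: inj_on_def)
    then show ?thesis
      using \<open>i \<in> I\<close> by blast
  qed auto
  have "X' n \<in> sets M \<and> Y' n \<in> sets M \<and> emeasure M (X' n) \<le> K * emeasure M (Y' n)" for n
    using fibre[of n]
  proof
    assume "\<exists>i\<in>I. {i\<in>I. g i = n} = {i}"
    then obtain i where "i \<in> I" "{i\<in>I. g i = n} = {i}" by blast
    then show ?thesis
      using X Y le by (simp add: X'_def Y'_def)
  next
    assume "{i\<in>I. g i = n} = {}"
    then have "X' n = {}" "Y' n = {}"
      unfolding X'_def Y'_def by blast+
    then show ?thesis by simp
  qed
  then have X'M: "X' n \<in> sets M" and Y'M: "Y' n \<in> sets M"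
    and le': "emeasure M (X' n) \<le> K * emeasure M (Y' n)" for n
    by auto
  have "disjoint_family Y'"
    unfolding disjoint_family_on_def
  proof (intro ballI impI)
    fix k n :: nat assume "k \<noteq> n"
    then have "Y i \<inter> Y j = {}" if "i \<in> I" "g i = k" "j \<in> I" "g j = n" for i j
      using that by (intro disjoint_family_onD[OF disj]) auto
    then show "Y' k \<inter> Y' n = {}"
      unfolding Y'_def by blast
  qed
  have "emeasure M (\<Union>i\<in>I. X i) = emeasure M (\<Union>n. X' n)"
    by (rule arg_cong[where f = "emeasure M"]) (auto simp: X'_def)
  also have "\<dots> \<le> (\<Sum>n. emeasure M (X' n))"
    using X'M by (intro emeasure_subadditive_countably) auto
  also have "\<dots> \<le> (\<Sum>n. K * emeasure M (Y' n))"
    using le' by (intro suminf_le) auto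
  also have "\<dots> = K * emeasure M (\<Union>n. Y' n)"
    using Y'M \<open>disjoint_family Y'\<close> by (subst suminf_emeasure[symmetric]) auto
  also have "(\<Union>n. Y' n) = (\<Union>i\<in>I. Y i)"
    by (auto simp: Y'_def)
  finally show ?thesis .
qed

text \<open>A subfamily that is maximal in \<open>P\<close> meets every member of \<open>K\<close>:
  if some were missed, one whose size exceeds half the supremum of the missed sizes could be added.
  The size \<open>r\<close> is an abstract label; for cylinders it is the radius.\<close>

lemma vitali_selection:
  fixes Q :: "'i \<Rightarrow> 'a set" and r :: "'i \<Rightarrow> real"
  assumes r: "\<And>i. i \<in> K \<Longrightarrow> 0 < r i \<and> r i \<le> B"
    and ne: "\<And>i. i \<in> K \<Longrightarrow> Q i \<noteq> {}"
  obtains D where "D \<subseteq> K" "disjoint_family_on Q D"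
    "\<forall>i\<in>K. \<exists>j\<in>D. Q i \<inter> Q j \<noteq> {} \<and> r i \<le> 2 * r j"
proof -
  \<comment> \<open>The size condition binds only the members that already meet \<open>D\<close>. It
    therefore holds for the empty family and passes to unions of chains, as Zorn's lemma
    requires.\<close>
  define P where "P = {D. D \<subseteq> K \<and> disjoint_family_on Q D \<and>
    (\<forall>i\<in>K. (\<exists>j\<in>D. Q i \<inter> Q j \<noteq> {}) \<longrightarrow> (\<exists>j\<in>D. Q i \<inter> Q j \<noteq> {} \<and> r i \<le> 2 * r j))}"
  have "\<exists>D\<in>P. \<forall>X\<in>P. D \<subseteq> X \<longrightarrow> X = D"
  proof (rule subset_Zorn')
    fix C assume C: "subset.chain P C"
    then have CP: "C \<subseteq> P" and lin: "\<And>X Y. X \<in> C \<Longrightarrow> Y \<in> C \<Longrightarrow> X \<subseteq> Y \<or> Y \<subseteq> X"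
      by (auto simp: subset_chain_def)
    have "disjoint_family_on Q (\<Union>C)"
      unfolding disjoint_family_on_def
    proof (intro ballI impI)
      fix i j assume "i \<in> \<Union>C" "j \<in> \<Union>C" "i \<noteq> j"
      then obtain X where "X \<in> C" "i \<in> X" "j \<in> X"
        using lin by blast
      then show "Q i \<inter> Q j = {}"
        using CP \<open>i \<noteq> j\<close> by (auto simp: P_def disjoint_family_on_def)
    qed
    then show "\<Union>C \<in> P"
      using CP unfolding P_def by fast
  qed
  then obtain D where D: "D \<in> P" and max: "\<And>X. X \<in> P \<Longrightarrow> D \<subseteq> X \<Longrightarrow> X = D"
    by blast
  have DK: "D \<subseteq> K" and disj: "disjoint_family_on Q D"
    using D by (auto simp: P_def)
  have meets: "\<exists>j\<in>D. Q i \<inter> Q j \<noteq> {}" if "i \<in> K" for i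
  proof (rule ccontr)
    assume iso: "\<not> ?thesis"
    define R where "R = {i\<in>K. \<forall>j\<in>D. Q i \<inter> Q j = {}}"
    have "i \<in> R"
      using iso that by (auto simp: R_def)
    have bdd: "bdd_above (r ` R)"
      using r by (auto simp: R_def bdd_above_def)
    have "r i \<le> Sup (r ` R)"
      using bdd \<open>i \<in> R\<close> by (intro cSup_upper) auto
    then have "Sup (r ` R) / 2 < Sup (r ` R)"
      using r[OF that] by auto
    \<comment> \<open>Up to the factor 2, \<open>k\<close> dominates all of \<open>R\<close>, so the
      sets that are met only through \<open>Q k\<close> satisfy the size condition in
      \<open>insert k D\<close>.\<close>
    then obtain k where k: "k \<in> R" "Sup (r ` R) / 2 < r k"
      using less_cSup_iff[OF _ bdd] \<open>i \<in> R\<close> by blast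
    have half: "r j \<le> 2 * r k" if "j \<in> R" for j
      using cSup_upper[OF imageI[OF that, of r] bdd] k by simp
    have "insert k D \<in> P"
      unfolding P_def mem_Collect_eq
    proof (intro conjI ballI impI)
      show "insert k D \<subseteq> K"
        using k DK by (auto simp: R_def)
      show "disjoint_family_on Q (insert k D)"
        using disj k(1) unfolding disjoint_family_on_def R_def by blast
      fix j assume "j \<in> K" "\<exists>l\<in>insert k D. Q j \<inter> Q l \<noteq> {}"
      show "\<exists>l\<in>insert k D. Q j \<inter> Q l \<noteq> {} \<and> r j \<le> 2 * r l"
      proof (cases "j \<in> R")
        case True
        then have "Q j \<inter> Q k \<noteq> {}"
          using \<open>\<exists>l\<in>insert k D. Q j \<inter> Q l \<noteq> {}\<close> by (auto simp: R_def)
        then show ?thesis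
          using half[OF True] by blast
      next
        case False
        then show ?thesis
          using D \<open>j \<in> K\<close> unfolding R_def P_def by blast
      qed
    qed
    then have "k \<in> D"
      using max by blast
    then show False
      using k ne by (auto simp: R_def)
  qed
  show thesis
    using that[OF DK disj] meets D unfolding P_def by blast
qed

text \<open>Each interval \<open>(a, a + m h)\<close> lies in a component \<open>J\<close> of the union \<open>V\<close> of these intervals, so
  \<open>h \<le> (sup J - a) / m\<close>; hence \<open>(a - h, a + m h)\<close> lies in the interval with right end \<open>sup J\<close> and length
  \<open>(m + 1) / m\<close> times that of \<open>J\<close>.\<close>

lemma emeasure_delayed_intervals:
  fixes A :: "(real \<times> real) set" and m :: real
  assumes m: "0 < m" and h: "\<And>a h. (a, h) \<in> A \<Longrightarrow> 0 < h"
  shows "emeasure lborel (\<Union>(a, h)\<in>A. {a - h<..<a + m * h})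
    \<le> ennreal ((m + 1) / m) * emeasure lborel (\<Union>(a, h)\<in>A. {a<..<a + m * h})"
    (is "emeasure lborel ?U \<le> _ * emeasure lborel ?V")
proof (cases "emeasure lborel ?V = \<infinity>")
  case True
  then show ?thesis
    using m by (simp add: ennreal_mult_top)
next
  case fin: False
  have opV: "open ?V" by auto
  have opJ: "open J" if "J \<in> components ?V" for J
    using that opV by (rule open_components[rotated])
  define L where "L J = measure lborel J" for J :: "real set"
  define W where "W J = {Sup J - L J - L J / m <..< Sup J}" for J
  \<comment> \<open>Finite total length makes each component finite in length and, by connectedness,
    bounded. Without this, \<open>measure\<close> could return its default 0 and
    \<open>Sup J\<close> would carry no information.\<close>
  have eJ: "emeasure lborel J = ennreal (L J)" if "J \<in> components ?V" for J
  proof -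
    have "emeasure lborel J \<le> emeasure lborel ?V"
      using that opV in_components_subset by (intro emeasure_mono) auto
    also have "\<dots> < \<infinity>"
      using fin by (simp add: top.not_eq_extremum)
    finally show ?thesis
      by (simp add: L_def emeasure_eq_ennreal_measure)
  qed
  have diam: "y - x \<le> L J" if J: "J \<in> components ?V" and "x \<in> J" "y \<in> J" for x y J
  proof (cases "x \<le> y")
    case True
    have "connected J" using J by (rule in_components_connected)
    then have "{x..y} \<subseteq> J"
      using that connected_contains_Icc by blast
    then have "emeasure lborel {x..y} \<le> emeasure lborel J"
      using opJ[OF J] by (intro emeasure_mono) auto
    then show ?thesis
      using True by (simp add: eJ[OF J] ennreal_le_iff L_def)
  next
    case False
    moreover have "0 \<le> L J" by (simp add: L_def)
    ultimately show ?thesis by linarith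
  qed
  have bdd: "bdd_above J" if J: "J \<in> components ?V" for J
  proof -
    obtain x where "x \<in> J" using in_components_nonempty[OF J] by blast
    then have "y \<le> x + L J" if "y \<in> J" for y
      using diam[OF J \<open>x \<in> J\<close> that] by simp
    then show ?thesis by (auto simp: bdd_above_def)
  qed
  have Wm: "emeasure lborel (W J) \<le> ennreal ((m + 1) / m) * emeasure lborel J" if "J \<in> components ?V" for J
  proof -
    have "0 \<le> L J" by (simp add: L_def)
    then show ?thesis
      using m by (simp add: W_def eJ[OF that] ennreal_mult[symmetric] field_simps)
  qed
  have cov: "?U \<subseteq> (\<Union>J\<in>components ?V. W J)"
  proof clarify
    fix a h u assume ah: "(a, h) \<in> A" and u: "u \<in> {a - h<..<a + m * h}"
    have "0 < m * h" using h[OF ah] m by simp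
    have sub: "{a<..<a + m * h} \<subseteq> ?V" using ah by auto
    have "{a<..<a + m * h} \<noteq> {}" using \<open>0 < m * h\<close> by auto
    then have "?V \<noteq> {}" using sub by blast
    then obtain J where J: "J \<in> components ?V" and aJ: "{a<..<a + m * h} \<subseteq> J"
      using exists_component_superset[OF sub] connected_Ioo by blast
    obtain w where w: "w = m * h" "0 < w" using \<open>0 < m * h\<close> by blast
    have IJ: "z \<in> J" if "a < z" "z < a + w" for z
      using aJ that by (auto simp: w)
    \<comment> \<open>The end points of the interval need not lie in \<open>J\<close>, so they are
      approached from inside; the midpoint \<open>a + w/2\<close> keeps the approximating points in
      the interval.\<close>
    have S1: "a + w \<le> Sup J"
    proof (rule dense_le)
      fix z assume "z < a + w"
      then have "max z (a + w/2) \<in> J" using w(2) by (intro IJ) auto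
      then have "max z (a + w/2) \<le> Sup J" using bdd[OF J] by (intro cSup_upper)
      then show "z \<le> Sup J" by simp
    qed
    have S2: "Sup J - L J \<le> a"
    proof (rule dense_ge)
      fix z assume "a < z"
      then have z: "min z (a + w/2) \<in> J" (is "?z \<in> J") using w(2) by (intro IJ) auto
      have "Sup J \<le> ?z + L J"
      proof (rule cSup_least)
        fix y assume "y \<in> J"
        then show "y \<le> ?z + L J" using diam[OF J z] by fastforce
      qed (use z in auto)
      then show "Sup J - L J \<le> z" by simp
    qed
    have "h \<le> (Sup J - a) / m" using S1 m by (simp add: w field_simps)
    also have "\<dots> \<le> (L J) / m" using S2 m by (intro divide_right_mono) auto
    finally have "Sup J - L J - L J / m \<le> a - h" using S2 by simp
    then show "u \<in> (\<Union>J\<in>components ?V. W J)"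
      using J u S1 by (auto simp: W_def w intro!: bexI[of _ J])
  qed
  have "emeasure lborel ?U \<le> emeasure lborel (\<Union>J\<in>components ?V. W J)"
    using cov by (rule emeasure_mono) (simp add: W_def borel_open open_UN)
  also have "\<dots> \<le> ennreal ((m + 1) / m) * emeasure lborel (\<Union>J\<in>components ?V. J)"
  proof (rule emeasure_UN_le_of_disjoint[OF _ _ _ _ Wm])
    show "countable (components ?V)"
    proof (rule countable_disjoint_open_subsets)
      show "pairwise disjnt (components ?V)"
        using pairwise_disjoint_components[of ?V] by (simp add: pairwise_def disjnt_def)
    qed (rule opJ)
    show "disjoint_family_on (\<lambda>J. J) (components ?V)"
      using pairwise_disjoint_components[of ?V] by (auto simp: disjoint_family_on_def pairwise_def disjnt_def)
    show "W J \<in> sets lborel" for J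
      by (simp add: W_def)
    show "J \<in> sets lborel" if "J \<in> components ?V" for J
      using opJ[OF that] by simp
  qed
  also have "(\<Union>J\<in>components ?V. J) = ?V"
    unfolding image_ident by (rule Union_components)
  finally show ?thesis .
qed

section \<open>Measure and covering geometry of parabolic cylinders\<close>

lemma emeasure_lborel_Times:
  fixes A :: "'a::euclidean_space set" and B :: "'b::euclidean_space set"
  assumes "A \<in> sets borel" "B \<in> sets borel"
  shows "emeasure lborel (A \<times> B) = emeasure lborel A * emeasure lborel B"
  using assms by (simp add: lborel.emeasure_pair_measure_Times flip: lborel_prod)

lemma sets_borel_cyl [measurable]: "cyl \<alpha> r y s \<in> sets borel"
  unfolding cyl_def borel_prod[symmetric] by (intro pair_measureI) auto

lemma emeasure_cyl:
  fixes y :: "real ^ 'd"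
  assumes "0 < r"
  shows "emeasure lebesgue (cyl \<alpha> r y s) = ennreal (unit_ball_vol CARD('d) * r ^ CARD('d) * r powr \<alpha>)"
proof -
  have "emeasure lebesgue (cyl \<alpha> r y s) = emeasure lborel (cyl \<alpha> r y s)"
    by (simp add: emeasure_completion)
  then show ?thesis
    using assms unfolding cyl_def
    by (subst (asm) emeasure_lborel_Times) (auto simp: emeasure_ball ennreal_mult)
qed

text \<open>Points of the cylinder of radius \<open>r'\<close> lie within \<open>r + 2 * r'\<close>
  of \<open>y\<close> in space and within \<open>r powr \<alpha> + r' powr \<alpha>\<close> of
  \<open>s\<close> in time. Since \<alpha> < 2, \<open>r' powr \<alpha>\<close> is at most
  \<open>4 * r powr \<alpha>\<close>, so the factor 5 is independent of \<alpha>.\<close>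

lemma cyl_engulf:
  fixes y :: "real ^ 'd"
  assumes \<alpha>: "0 < \<alpha>" "\<alpha> < 2" and r: "0 < r" "0 < r'" "r' \<le> 2 * r"
    and meet: "cyl \<alpha> r' y' s' \<inter> cyl \<alpha> r y s \<noteq> {}"
  shows "cyl \<alpha> r' y' s' \<subseteq> ball y (5 * r) \<times> {s - 5 * r powr \<alpha> .. s + 5 * r powr \<alpha>}"
proof -
  have "r' powr \<alpha> \<le> (2 * r) powr \<alpha>"
    using \<alpha> r by (intro powr_mono2) auto
  also have "\<dots> = 2 powr \<alpha> * r powr \<alpha>"
    using r by (simp add: powr_mult)
  also have "\<dots> \<le> 2 powr 2 * r powr \<alpha>"
    using \<alpha> by (intro mult_right_mono powr_mono) auto
  finally have h: "r' powr \<alpha> \<le> 4 * r powr \<alpha>" by simp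
  obtain x t where xt: "x \<in> ball y' r'" "x \<in> ball y r"
    "s' - r' powr \<alpha> < t" "t \<le> s'" "s - r powr \<alpha> < t" "t \<le> s"
    using meet by (auto simp: cyl_def)
  have "ball y' r' \<subseteq> ball y (5 * r)"
  proof
    fix z assume "z \<in> ball y' r'"
    then have "dist y z < r + r' + r'"
      using xt dist_triangle[of y z x] dist_triangle[of x z y'] by (simp add: dist_commute)
    then show "z \<in> ball y (5 * r)" using r by simp
  qed
  then show ?thesis
    using xt h by (auto simp: cyl_def)
qed

text \<open>The ball contributes \<open>5 ^ CARD('d)\<close> and the two-sided time interval
  contributes 10, so the factor depends on the dimension alone.\<close>

lemma emeasure_cyl_engulf:
  fixes y :: "real ^ 'd"
  assumes "0 < r"
  shows "emeasure lebesgue (ball y (5 * r) \<times> {s - 5 * r powr \<alpha> .. s + 5 * r powr \<alpha>})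
    = ennreal (10 * 5 ^ CARD('d)) * emeasure lebesgue (cyl \<alpha> r y s)"
proof -
  have "ball y (5 * r) \<times> {s - 5 * r powr \<alpha> .. s + 5 * r powr \<alpha>} \<in> sets borel"
    unfolding borel_prod[symmetric] by (intro pair_measureI) auto
  then have "emeasure lebesgue (ball y (5 * r) \<times> {s - 5 * r powr \<alpha> .. s + 5 * r powr \<alpha>})
    = emeasure lborel (ball y (5 * r)) * emeasure lborel {s - 5 * r powr \<alpha> .. s + 5 * r powr \<alpha>}"
    by (simp add: emeasure_completion emeasure_lborel_Times)
  also have "\<dots> = ennreal (unit_ball_vol CARD('d) * (5 * r) ^ CARD('d)) * ennreal (10 * r powr \<alpha>)"
    using assms by (simp add: emeasure_ball)
  also have "\<dots> = ennreal (10 * 5 ^ CARD('d)) * emeasure lebesgue (cyl \<alpha> r y s)"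
    unfolding emeasure_cyl[OF assms] using assms
    by (simp add: ennreal_mult[symmetric] power_mult_distrib mult_ac)
  finally show ?thesis .
qed

text \<open>Splitting \<open>Q\<close> along \<open>E\<close>, the part inside \<open>E\<close> is
  absorbed into the left side, which finiteness of the measure of \<open>Q\<close> permits.\<close>

lemma emeasure_Diff_ge:
  assumes Q: "Q \<in> sets M" and E: "E \<in> sets M" and fin: "emeasure M Q < \<infinity>" and \<kappa>: "0 \<le> \<kappa>" "\<kappa> < 1"
    and le: "emeasure M (E \<inter> Q) \<le> ennreal \<kappa> * emeasure M Q"
  shows "emeasure M Q \<le> ennreal (1 / (1 - \<kappa>)) * emeasure M (Q - E)"
proof -
  obtain q where q: "emeasure M Q = ennreal q" "0 \<le> q"
    using fin by (cases "emeasure M Q") auto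
  have "emeasure M (Q - E) \<le> emeasure M Q"
    using Q E by (intro emeasure_mono) auto
  then obtain z where z: "emeasure M (Q - E) = ennreal z" "0 \<le> z"
    using fin by (cases "emeasure M (Q - E)") auto
  have "emeasure M Q = emeasure M (E \<inter> Q) + emeasure M (Q - E)"
    using Q E by (subst plus_emeasure) (auto intro!: arg_cong[where f = "emeasure M"])
  also have "\<dots> \<le> ennreal \<kappa> * emeasure M Q + emeasure M (Q - E)"
    using le by (rule add_right_mono)
  finally have "ennreal q \<le> ennreal (\<kappa> * q + z)"
    using q z \<kappa> by (simp add: ennreal_mult)
  then have "q \<le> \<kappa> * q + z"
    using q z \<kappa> by (subst (asm) ennreal_le_iff) auto
  then have "q \<le> 1 / (1 - \<kappa>) * z"
    using \<kappa> by (simp add: field_simps)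
  then have "ennreal q \<le> ennreal (1 / (1 - \<kappa>) * z)"
    by (rule ennreal_leI)
  then show ?thesis
    using q z \<kappa> by (simp add: ennreal_mult[symmetric])
qed

text \<open>The enlargements \<open>big i\<close> of disjoint selected cylinders cover
  \<open>A\<close>. Each is charged to \<open>Q i - E\<close>, which fills at least the fraction
  \<open>1 - \<kappa>\<close> of \<open>Q i\<close>, and these pieces are disjoint inside
  \<open>U - E\<close>. The measurable cover \<open>W\<close> allows \<open>A\<close> to be an
  arbitrary set.\<close>

lemma cyl_cover:
  fixes A E U :: "((real ^ 'd) \<times> real) set"
  assumes \<alpha>: "0 < \<alpha>" "\<alpha> < 2" and E: "E \<in> sets lebesgue" and U: "U \<in> sets lebesgue"
    and \<kappa>: "0 \<le> \<kappa>" "\<kappa> < 1"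
    and cov: "\<And>p. p \<in> A \<Longrightarrow> \<exists>r y s. 0 < r \<and> r \<le> 1 \<and> p \<in> cyl \<alpha> r y s \<and> cyl \<alpha> r y s \<subseteq> U \<and>
      emeasure lebesgue (E \<inter> cyl \<alpha> r y s) \<le> ennreal \<kappa> * emeasure lebesgue (cyl \<alpha> r y s)"
  obtains W where "W \<in> sets lebesgue" "A \<subseteq> W"
    "emeasure lebesgue W \<le> ennreal (10 * 5 ^ CARD('d) / (1 - \<kappa>)) * emeasure lebesgue (U - E)"
proof -
  define K where "K = {(r, y, s). 0 < r \<and> r \<le> 1 \<and> cyl \<alpha> r y s \<subseteq> U \<and>
    emeasure lebesgue (E \<inter> cyl \<alpha> r y s) \<le> ennreal \<kappa> * emeasure lebesgue (cyl \<alpha> r (y :: real ^ 'd) s)}"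
  define Q where "Q = (\<lambda>(r, y :: real ^ 'd, s). cyl \<alpha> r y s)"
  define big where "big = (\<lambda>(r, y :: real ^ 'd, s). ball y (5 * r) \<times> {s - 5 * r powr \<alpha> .. s + 5 * r powr \<alpha>})"
  have ne: "Q i \<noteq> {}" if "i \<in> K" for i
    using that by (auto simp: K_def Q_def cyl_def)
  have bd: "0 < fst i \<and> fst i \<le> 1" if "i \<in> K" for i
    using that by (cases i) (simp add: K_def)
  obtain D where D: "D \<subseteq> K" and disj: "disjoint_family_on Q D"
    and sel: "\<And>i. i \<in> K \<Longrightarrow> \<exists>j\<in>D. Q i \<inter> Q j \<noteq> {} \<and> fst i \<le> 2 * fst j"
  proof (rule vitali_selection[of K fst 1 Q])
    show "0 < fst i \<and> fst i \<le> 1" "Q i \<noteq> {}" if "i \<in> K" for i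
      using that by (rule bd, rule ne)
  next
    fix D assume "D \<subseteq> K" "disjoint_family_on Q D"
      "\<forall>i\<in>K. \<exists>j\<in>D. Q i \<inter> Q j \<noteq> {} \<and> fst i \<le> 2 * fst j"
    then show thesis using that by blast
  qed
  \<comment> \<open>Disjoint sets with nonempty interior are countably many. As no selected cylinder
    is empty, \<open>Q\<close> is injective on \<open>D\<close>, and countability passes to the
    indices.\<close>
  have "countable D"
  proof -
    have "inj_on Q D"
    proof (rule inj_onI, rule ccontr)
      fix i j assume "i \<in> D" "j \<in> D" "Q i = Q j" "i \<noteq> j"
      then have "Q i = {}"
        using disjoint_family_onD[OF disj, of i j] by simp
      then show False
        using ne D \<open>i \<in> D\<close> by blast
    qed
    moreover have "countable (Q ` D)"
    proof (rule countable_disjoint_nonempty_interior_subsets)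
      show "pairwise disjnt (Q ` D)"
        unfolding pairwise_def disjnt_def
      proof (intro ballI impI)
        fix S T assume "S \<in> Q ` D" "T \<in> Q ` D" "S \<noteq> T"
        then obtain i j where "i \<in> D" "j \<in> D" "S = Q i" "T = Q j" "i \<noteq> j" by blast
        then show "S \<inter> T = {}"
          using disjoint_family_onD[OF disj] by simp
      qed
      fix S assume S: "S \<in> Q ` D" "interior S = {}"
      then obtain r y s where "S = cyl \<alpha> r y s" "0 < r"
        using D by (auto simp: K_def Q_def)
      moreover from this have "y \<in> ball y r" "s - r powr \<alpha> / 2 \<in> {s - r powr \<alpha> <..< s}" by auto
      ultimately have "(y, s - r powr \<alpha> / 2) \<in> interior S"
        by (auto simp: interior_Times cyl_def)
      then show "S = {}" using S by simp
    qed
    ultimately show ?thesis by (rule countable_image_inj_on[rotated])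
  qed
  have Qm: "Q i - E \<in> sets lebesgue" and bm: "big i \<in> sets lebesgue" for i
  proof -
    have "big i \<in> sets borel"
      unfolding big_def borel_prod[symmetric] by (auto split: prod.split intro!: pair_measureI)
    then show "big i \<in> sets lebesgue" by auto
    have "Q i \<in> sets borel" by (auto simp: Q_def split: prod.split)
    then show "Q i - E \<in> sets lebesgue" using E by auto
  qed
  have le: "emeasure lebesgue (big i) \<le> ennreal (10 * 5 ^ CARD('d) / (1 - \<kappa>)) * emeasure lebesgue (Q i - E)"
    if "i \<in> D" for i
  proof -
    obtain r y s where i: "i = (r, y, s)" by (cases i) auto
    have r: "0 < r" and bad: "emeasure lebesgue (E \<inter> cyl \<alpha> r y s) \<le> ennreal \<kappa> * emeasure lebesgue (cyl \<alpha> r y s)"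
      using that D i by (auto simp: K_def)
    have "emeasure lebesgue (big i) = ennreal (10 * 5 ^ CARD('d)) * emeasure lebesgue (cyl \<alpha> r y s)"
      unfolding i big_def using emeasure_cyl_engulf[OF r] by simp
    also have "\<dots> \<le> ennreal (10 * 5 ^ CARD('d)) * (ennreal (1 / (1 - \<kappa>)) * emeasure lebesgue (cyl \<alpha> r y s - E))"
      using E \<kappa> bad by (intro mult_left_mono emeasure_Diff_ge) (auto simp: emeasure_cyl[OF r])
    also have "\<dots> = ennreal (10 * 5 ^ CARD('d) / (1 - \<kappa>)) * emeasure lebesgue (Q i - E)"
      using \<kappa> by (simp add: i Q_def mult.assoc[symmetric] ennreal_mult[symmetric])
    finally show ?thesis .
  qed
  show thesis
  proof
    show "(\<Union>i\<in>D. big i) \<in> sets lebesgue"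
      using \<open>countable D\<close> bm by (intro sets.countable_UN') auto
    show "A \<subseteq> (\<Union>i\<in>D. big i)"
    proof
      fix p assume "p \<in> A"
      then obtain i where i: "i \<in> K" "p \<in> Q i"
        using cov[OF \<open>p \<in> A\<close>] by (auto simp: K_def Q_def)
      then obtain j where j: "j \<in> D" "Q i \<inter> Q j \<noteq> {}" "fst i \<le> 2 * fst j"
        using sel by blast
      have "Q i \<subseteq> big j"
      proof -
        obtain r y s r' y' s' where ij: "i = (r', y', s')" "j = (r, y, s)"
          by (cases i, cases j) blast
        have "0 < r" "0 < r'" "r' \<le> 2 * r"
          using bd[OF i(1)] bd[of j] j D by (auto simp: ij)
        moreover have "cyl \<alpha> r' y' s' \<inter> cyl \<alpha> r y s \<noteq> {}"
          using j by (simp add: ij Q_def)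
        ultimately have "cyl \<alpha> r' y' s' \<subseteq> ball y (5 * r) \<times> {s - 5 * r powr \<alpha> .. s + 5 * r powr \<alpha>}"
          by (rule cyl_engulf[OF \<alpha>])
        then show ?thesis
          by (simp add: ij Q_def big_def)
      qed
      then show "p \<in> (\<Union>i\<in>D. big i)" using i j by blast
    qed
    have "emeasure lebesgue (\<Union>i\<in>D. big i)
      \<le> ennreal (10 * 5 ^ CARD('d) / (1 - \<kappa>)) * emeasure lebesgue (\<Union>i\<in>D. Q i - E)"
    proof (rule emeasure_UN_le_of_disjoint[OF \<open>countable D\<close> bm Qm _ le])
      show "disjoint_family_on (\<lambda>i. Q i - E) D"
        using disj unfolding disjoint_family_on_def by blast
    qed
    also have "\<dots> \<le> ennreal (10 * 5 ^ CARD('d) / (1 - \<kappa>)) * emeasure lebesgue (U - E)"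
    proof (intro mult_left_mono emeasure_mono)
      show "(\<Union>i\<in>D. Q i - E) \<subseteq> U - E" using D by (auto simp: K_def Q_def)
    qed (use U E in auto)
    finally show "emeasure lebesgue (\<Union>i\<in>D. big i)
      \<le> ennreal (10 * 5 ^ CARD('d) / (1 - \<kappa>)) * emeasure lebesgue (U - E)" .
  qed
qed

section \<open>Shrinking cylinders towards a point, and densities\<close>

text \<open>The contraction that fixes \<open>p\<close>, by \<open>c\<close> in space and by
  \<open>c powr \<alpha>\<close> in time, maps cylinders to cylinders, and the image stays inside by
  convexity. The witnesses \<open>y'\<close> and \<open>s'\<close> are the images of
  \<open>y\<close> and \<open>s\<close>.\<close>

lemma cyl_shrink:
  fixes y :: "real ^ 'd"
  assumes p: "p \<in> cyl \<alpha> r y s" and \<alpha>: "0 < \<alpha>" and r: "0 < r" and c: "0 < c" "c \<le> 1"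
  obtains y' s' where "p \<in> cyl \<alpha> (c * r) y' s'" "cyl \<alpha> (c * r) y' s' \<subseteq> cyl \<alpha> r y s"
proof -
  obtain x t where xt: "p = (x, t)" "dist y x < r" "s - r powr \<alpha> < t" "t \<le> s"
    using p by (cases p) (auto simp: cyl_def)
  define y' where "y' = x + c *\<^sub>R (y - x)"
  define k where "k = c powr \<alpha>"
  define s' where "s' = t + k * (s - t)"
  have k: "0 < k" "k \<le> 1"
    using c \<alpha> powr_mono2[of \<alpha> c 1] by (auto simp: k_def)
  have cr: "(c * r) powr \<alpha> = k * r powr \<alpha>"
    using c r by (simp add: k_def powr_mult)
  have "dist y' x = c * dist y x"
    using c by (simp add: y'_def dist_norm)
  then have "dist y' x < c * r"
    using xt c by simp
  moreover have "k * (s - t - r powr \<alpha>) < 0" "0 \<le> k * (s - t)"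
    using k xt by (auto simp: mult_less_0_iff)
  then have "s' - k * r powr \<alpha> < t" "t \<le> s'"
    by (auto simp: s'_def algebra_simps)
  ultimately have 1: "p \<in> cyl \<alpha> (c * r) y' s'"
    by (simp add: cyl_def xt cr)
  have "y - y' = (1 - c) *\<^sub>R (y - x)"
    by (simp add: y'_def algebra_simps)
  then have "dist y y' = (1 - c) * dist y x"
    using c by (simp add: dist_norm)
  also have "\<dots> \<le> (1 - c) * r"
    using c xt by (intro mult_left_mono) auto
  finally have "dist y' y + c * r \<le> r"
    by (simp add: algebra_simps dist_commute)
  then have "ball y' (c * r) \<subseteq> ball y r"
    by (simp add: ball_subset_ball_iff)
  moreover have "k * (s - t) \<le> 1 * (s - t)" "k * (t - (s - r powr \<alpha>)) \<le> 1 * (t - (s - r powr \<alpha>))"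
    using k xt by (intro mult_right_mono; simp)+
  then have "s' \<le> s" "s - r powr \<alpha> \<le> s' - k * r powr \<alpha>"
    by (auto simp: s'_def algebra_simps)
  ultimately have "cyl \<alpha> (c * r) y' s' \<subseteq> cyl \<alpha> r y s"
    by (auto simp: cyl_def cr)
  with 1 show thesis by (rule that)
qed

lemma small_cyl_subset:
  fixes T :: "((real ^ 'd) \<times> real) set"
  assumes "open T" "p \<in> T" "0 < \<alpha>"
  shows "\<exists>\<epsilon>>0. \<forall>r y s. 0 < r \<longrightarrow> r < \<epsilon> \<longrightarrow> p \<in> cyl \<alpha> r y s \<longrightarrow> cyl \<alpha> r y s \<subseteq> T"
proof -
  obtain A B where AB: "open A" "open B" "p \<in> A \<times> B" "A \<times> B \<subseteq> T"
    using assms open_prod_elim by metis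
  obtain x t where p: "p = (x, t)" by (cases p)
  obtain a where a: "0 < a" "ball x a \<subseteq> A"
    using AB p openE[of A x] by auto
  obtain b where b: "0 < b" "ball t b \<subseteq> B"
    using AB p openE[of B t] by auto
  note ab = a b
  show ?thesis
  \<comment> \<open>A ball of radius \<open>r\<close> containing \<open>x\<close> lies within
    \<open>2 * r\<close> of \<open>x\<close>, whence \<open>a / 2\<close>; the other bound makes the
    time length \<open>r powr \<alpha>\<close> smaller than \<open>b\<close>.\<close>
  proof (intro exI[of _ "min (a / 2) (b powr (1 / \<alpha>))"] conjI allI impI)
    show "0 < min (a / 2) (b powr (1 / \<alpha>))" using ab by simp
    fix r s and y :: "real ^ 'd"
    assume r: "0 < r" "r < min (a / 2) (b powr (1 / \<alpha>))" and pc: "p \<in> cyl \<alpha> r y s"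
    have "r powr \<alpha> < (b powr (1 / \<alpha>)) powr \<alpha>"
      using r assms by (intro powr_less_mono2) auto
    then have rb: "r powr \<alpha> < b"
      using ab assms by (simp add: powr_powr)
    have "ball y r \<subseteq> ball x a"
    proof
      fix z assume "z \<in> ball y r"
      then show "z \<in> ball x a"
        using pc r dist_triangle[of x z y] by (simp add: p cyl_def dist_commute)
    qed
    moreover have "{s - r powr \<alpha> <.. s} \<subseteq> ball t b"
      using pc rb by (auto simp: p cyl_def dist_real_def)
    ultimately show "cyl \<alpha> r y s \<subseteq> T"
      using ab AB unfolding cyl_def by blast
  qed
qed

text \<open>A density theorem for cylinders, proved by covering: an open \<open>T\<close> around
  \<open>E\<close> with \<open>T - E\<close> tiny contains sparse cylinders around every point of
  \<open>N\<close>, and \<open>cyl_cover\<close> bounds a cover of \<open>N\<close> by a constant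
  times the measure of \<open>T - E\<close>.\<close>

lemma null_sets_of_small_density:
  fixes E N :: "((real ^ 'd) \<times> real) set"
  assumes \<alpha>: "0 < \<alpha>" "\<alpha> < 2" and E: "E \<in> sets lebesgue" and "N \<subseteq> E" and \<kappa>: "0 \<le> \<kappa>" "\<kappa> < 1"
    and small: "\<And>p \<epsilon>. p \<in> N \<Longrightarrow> 0 < \<epsilon> \<Longrightarrow> \<exists>r y s. 0 < r \<and> r < \<epsilon> \<and> p \<in> cyl \<alpha> r y s \<and>
      emeasure lebesgue (E \<inter> cyl \<alpha> r y s) \<le> ennreal \<kappa> * emeasure lebesgue (cyl \<alpha> r y s)"
  shows "N \<in> null_sets lebesgue"
  unfolding negligible_iff_null_sets[symmetric] negligible_outer_le
proof (intro allI impI)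
  fix e :: real assume "0 < e"
  define C where "C = 10 * 5 ^ CARD('d) / (1 - \<kappa>)"
  have "0 < C" using \<kappa> by (simp add: C_def)
  then have "0 < e / C" using \<open>0 < e\<close> by simp
  then obtain T where T: "open T" "E \<subseteq> T" "emeasure lebesgue (T - E) < ennreal (e / C)"
    using sets_lebesgue_outer_open[OF E] by blast
  have cov: "\<exists>r y s. 0 < r \<and> r \<le> 1 \<and> p \<in> cyl \<alpha> r y s \<and> cyl \<alpha> r y s \<subseteq> T \<and>
      emeasure lebesgue (E \<inter> cyl \<alpha> r y s) \<le> ennreal \<kappa> * emeasure lebesgue (cyl \<alpha> r y s)" if pN: "p \<in> N" for p
  proof -
    have "p \<in> T" using pN T \<open>N \<subseteq> E\<close> by auto
    then obtain \<epsilon> where \<epsilon>: "0 < \<epsilon>"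
        "\<forall>r y s. 0 < r \<longrightarrow> r < \<epsilon> \<longrightarrow> p \<in> cyl \<alpha> r y s \<longrightarrow> cyl \<alpha> r y s \<subseteq> T"
      using small_cyl_subset[OF T(1) _ \<alpha>(1)] by blast
    \<comment> \<open>The bound \<open>\<epsilon>\<close> keeps the cylinder inside
      \<open>T\<close>; the cap 1 is the radius bound in \<open>cyl_cover\<close>.\<close>
    obtain r y s where "0 < r" "r < min \<epsilon> 1" "p \<in> cyl \<alpha> r y s"
      "emeasure lebesgue (E \<inter> cyl \<alpha> r y s) \<le> ennreal \<kappa> * emeasure lebesgue (cyl \<alpha> r y s)"
      using small[OF pN, of "min \<epsilon> 1"] \<epsilon>(1) by auto
    then show ?thesis
      using \<epsilon>(2) by (intro exI[of _ r] exI[of _ y] exI[of _ s]) auto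
  qed
  have "T \<in> sets lebesgue" using T(1) by auto
  then obtain W where W: "W \<in> sets lebesgue" "N \<subseteq> W"
    "emeasure lebesgue W \<le> ennreal C * emeasure lebesgue (T - E)"
    using cyl_cover[OF \<alpha> E _ \<kappa> cov] unfolding C_def by blast
  have "emeasure lebesgue W \<le> ennreal C * ennreal (e / C)"
    using W(3) T(3) by (meson less_imp_le mult_left_mono order_trans zero_le)
  also have "\<dots> = ennreal e"
    using \<open>0 < C\<close> \<open>0 < e\<close> by (simp add: ennreal_mult[symmetric])
  finally have We: "emeasure lebesgue W \<le> ennreal e" .
  then have "W \<in> lmeasurable"
    using W(1) by (auto simp: fmeasurable_def intro: le_less_trans)
  moreover have "measure lebesgue W \<le> e"
    using We \<open>0 < e\<close> by (simp add: measure_def enn2real_leI)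
  ultimately show "\<exists>T. N \<subseteq> T \<and> T \<in> lmeasurable \<and> measure lebesgue T \<le> e"
    using W(2) by blast
qed

text \<open>A discrete intermediate value argument: the density is at most \<open>1 - \<mu>\<close>
  at the start and above it on all small cylinders around \<open>p\<close>, so it crosses this level
  during shrinking. Short steps prevent it from jumping beyond \<open>1 - \<mu> / 2\<close>.\<close>

lemma critical_cylinder:
  fixes E :: "((real ^ 'd) \<times> real) set"
  assumes \<alpha>: "0 < \<alpha>" "\<alpha> < 2" and \<mu>: "0 < \<mu>" "\<mu> < 1" and E: "E \<in> sets lebesgue" and "0 < r0"
    and Q0: "cyl \<alpha> r0 y0 s0 \<subseteq> B" "p \<in> cyl \<alpha> r0 y0 s0"
      "emeasure lebesgue (E \<inter> cyl \<alpha> r0 y0 s0) \<le> ennreal (1 - \<mu>) * emeasure lebesgue (cyl \<alpha> r0 y0 s0)"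
    and "0 < \<epsilon>"
    and large: "\<And>r y s. 0 < r \<Longrightarrow> r < \<epsilon> \<Longrightarrow> p \<in> cyl \<alpha> r y s \<Longrightarrow>
      ennreal (1 - \<mu>) * emeasure lebesgue (cyl \<alpha> r y s) < emeasure lebesgue (E \<inter> cyl \<alpha> r y s)"
  shows "\<exists>r y s. 0 < r \<and> p \<in> cyl \<alpha> r y s \<and> cyl \<alpha> r y s \<subseteq> B \<and>
      ennreal (1 - \<mu>) * emeasure lebesgue (cyl \<alpha> r y s) < emeasure lebesgue (E \<inter> cyl \<alpha> r y s) \<and>
      emeasure lebesgue (E \<inter> cyl \<alpha> r y s) \<le> ennreal (1 - \<mu> / 2) * emeasure lebesgue (cyl \<alpha> r y s)"
proof (rule ccontr)
  assume none: "\<not> ?thesis"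
  define d where "d = CARD('d)"
  \<comment> \<open>Shrinking by this factor raises the density at most from \<open>1 - \<mu>\<close> to \<open>1 - \<mu> / 2\<close>, so without a
    cylinder as claimed all the shrunk ones stay sparse.\<close>
  define c where "c = ((1 - \<mu>) / (1 - \<mu> / 2)) powr (1 / real (d + 2))"
  have q: "0 < (1 - \<mu>) / (1 - \<mu> / 2)" "(1 - \<mu>) / (1 - \<mu> / 2) < 1"
    using \<mu> by (auto simp: field_simps)
  have c: "0 < c" "c < 1"
    using q powr_less_mono2[of "1 / real (d + 2)" "(1 - \<mu>) / (1 - \<mu> / 2)" 1] by (auto simp: c_def)
  have "c ^ (d + 2) = c powr real (d + 2)"
    using c by (simp only: powr_realpow)
  also have "\<dots> = (1 - \<mu>) / (1 - \<mu> / 2)"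
    using \<mu> by (simp add: c_def powr_powr del: of_nat_add)
  finally have "(1 - \<mu>) / (1 - \<mu> / 2) = c ^ (d + 2)" ..
  also have "\<dots> = c ^ d * c powr 2"
    using c by (simp add: power_add power2_eq_square)
  \<comment> \<open>As \<open>c < 1\<close> and \<alpha> < 2, one step keeps at least the fraction
    \<open>c ^ (d + 2)\<close> of the volume; hence the exponent \<open>d + 2\<close> in the choice
    of \<open>c\<close>.\<close>
  also have "\<dots> \<le> c ^ d * c powr \<alpha>"
    using c \<alpha> by (intro mult_left_mono powr_mono') auto
  finally have cd: "1 - \<mu> \<le> (1 - \<mu> / 2) * (c ^ d * c powr \<alpha>)"
    using \<mu> by (simp add: field_simps)
  have "\<exists>y s. p \<in> cyl \<alpha> (c ^ n * r0) y s \<and> cyl \<alpha> (c ^ n * r0) y s \<subseteq> B \<and>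
    emeasure lebesgue (E \<inter> cyl \<alpha> (c ^ n * r0) y s) \<le> ennreal (1 - \<mu>) * emeasure lebesgue (cyl \<alpha> (c ^ n * r0) y s)" for n
  proof (induction n)
    case 0
    then show ?case using Q0 by auto
  next
    case (Suc n)
    define r where "r = c ^ n * r0"
    have r: "0 < r" using c \<open>0 < r0\<close> by (simp add: r_def)
    obtain y s where ys: "p \<in> cyl \<alpha> r y s" "cyl \<alpha> r y s \<subseteq> B"
      "emeasure lebesgue (E \<inter> cyl \<alpha> r y s) \<le> ennreal (1 - \<mu>) * emeasure lebesgue (cyl \<alpha> r y s)"
      using Suc by (auto simp: r_def)
    obtain y' s' where ys': "p \<in> cyl \<alpha> (c * r) y' s'" "cyl \<alpha> (c * r) y' s' \<subseteq> cyl \<alpha> r y s"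
      using cyl_shrink[OF ys(1) \<alpha>(1) r] c by (metis less_imp_le)
    have cr: "0 < c * r" using c r by simp
    define V where "V = unit_ball_vol d * r ^ d * r powr \<alpha>"
    have "0 \<le> V" using r by (simp add: V_def)
    have eQ: "emeasure lebesgue (cyl \<alpha> r y s) = ennreal V"
      by (simp add: emeasure_cyl[OF r] V_def d_def)
    have eQ': "emeasure lebesgue (cyl \<alpha> (c * r) y' s') = ennreal (c ^ d * c powr \<alpha> * V)"
      using c r by (simp add: emeasure_cyl[OF cr] V_def d_def power_mult_distrib powr_mult mult_ac)
    have "emeasure lebesgue (E \<inter> cyl \<alpha> (c * r) y' s') \<le> emeasure lebesgue (E \<inter> cyl \<alpha> r y s)"
      using E ys' by (intro emeasure_mono) auto
    also have "\<dots> \<le> ennreal (1 - \<mu>) * ennreal V"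
      using ys(3) eQ by simp
    also have "\<dots> = ennreal ((1 - \<mu>) * V)"
      using \<mu> \<open>0 \<le> V\<close> by (simp add: ennreal_mult)
    also have "\<dots> \<le> ennreal ((1 - \<mu> / 2) * (c ^ d * c powr \<alpha>) * V)"
      using cd \<open>0 \<le> V\<close> by (intro ennreal_leI mult_right_mono)
    also have "\<dots> = ennreal (1 - \<mu> / 2) * emeasure lebesgue (cyl \<alpha> (c * r) y' s')"
      using \<mu> c \<open>0 \<le> V\<close> by (simp add: eQ' ennreal_mult[symmetric] mult.assoc)
    \<comment> \<open>The density bound just obtained is one half of what \<open>none\<close>
      excludes, so the other half, heaviness, must fail.\<close>
    finally have "\<not> ennreal (1 - \<mu>) * emeasure lebesgue (cyl \<alpha> (c * r) y' s')
        < emeasure lebesgue (E \<inter> cyl \<alpha> (c * r) y' s')"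
      using none cr ys' ys(2) by blast
    then have "emeasure lebesgue (E \<inter> cyl \<alpha> (c * r) y' s')
        \<le> ennreal (1 - \<mu>) * emeasure lebesgue (cyl \<alpha> (c * r) y' s')"
      by simp
    moreover have "c ^ Suc n * r0 = c * r" by (simp add: r_def)
    ultimately show ?case
      using ys' ys(2) by (metis order_trans)
  qed
  note bad = this
  have "(\<lambda>n. c ^ n * r0) \<longlonglongrightarrow> 0"
    using c by (intro tendsto_mult_left_zero LIMSEQ_power_zero) auto
  then have "eventually (\<lambda>n. c ^ n * r0 < \<epsilon>) sequentially"
    using \<open>0 < \<epsilon>\<close> by (rule order_tendstoD)
  then obtain n where "c ^ n * r0 < \<epsilon>"
    by (meson eventually_happens' sequentially_bot)
  moreover have "0 < c ^ n * r0" using c \<open>0 < r0\<close> by simp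
  ultimately show False
    using bad[of n] large[of "c ^ n * r0"] by (meson not_le)
qed

section \<open>Fubini for the stacked cylinders\<close>

text \<open>On the time slice over \<open>x\<close>, each cylinder whose ball contains
  \<open>x\<close> leaves the intervals with \<open>a = s\<close> and
  \<open>h = r powr \<alpha>\<close>, to which \<open>emeasure_delayed_intervals\<close> applies;
  integration over \<open>x\<close> finishes.\<close>

lemma emeasure_delayed_union:
  fixes K :: "(real \<times> (real ^ 'd) \<times> real) set"
  assumes m: "0 < m" and r: "\<And>r y s. (r, y, s) \<in> K \<Longrightarrow> 0 < r"
  shows "emeasure lborel (\<Union>(r, y, s)\<in>K. ball y r \<times> {s - r powr \<alpha> <..< s + m * r powr \<alpha>})
    \<le> ennreal ((m + 1) / m) * emeasure lborel (\<Union>(r, y, s)\<in>K. stacked_cyl \<alpha> m r y s)"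
    (is "emeasure lborel ?G \<le> _ * emeasure lborel ?H")
proof -
  \<comment> \<open>Since \<open>K\<close> may be uncountable, measurability of the unions comes
    from openness.\<close>
  have opG: "open ?G" and opH: "open ?H"
    by (auto simp: stacked_cyl_def intro!: open_Times)
  have G: "?G \<in> sets (lborel \<Otimes>\<^sub>M lborel)" and H: "?H \<in> sets (lborel \<Otimes>\<^sub>M lborel)"
    using opG opH unfolding lborel_prod by simp_all
  have slice: "emeasure lborel (Pair x -` ?G) \<le> ennreal ((m + 1) / m) * emeasure lborel (Pair x -` ?H)" for x
  proof -
    define A where "A = (\<lambda>(r, y, s). (s, r powr \<alpha>)) ` {(r, y, s) \<in> K. x \<in> ball y r}"
    have "Pair x -` ?G = (\<Union>(a, h)\<in>A. {a - h<..<a + m * h})"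
      by (force simp: A_def)
    moreover have "Pair x -` ?H = (\<Union>(a, h)\<in>A. {a<..<a + m * h})"
      by (force simp: A_def stacked_cyl_def)
    moreover have "0 < h" if "(a, h) \<in> A" for a h
      using that r by (fastforce simp: A_def)
    ultimately show ?thesis
      using emeasure_delayed_intervals[OF m, of A] by simp
  qed
  have "emeasure lborel ?G = (\<integral>\<^sup>+x. emeasure lborel (Pair x -` ?G) \<partial>lborel)"
    using lborel.emeasure_pair_measure_alt[OF G] unfolding lborel_prod .
  also have "\<dots> \<le> (\<integral>\<^sup>+x. ennreal ((m + 1) / m) * emeasure lborel (Pair x -` ?H) \<partial>lborel)"
    using slice by (intro nn_integral_mono)
  also have "\<dots> = ennreal ((m + 1) / m) * (\<integral>\<^sup>+x. emeasure lborel (Pair x -` ?H) \<partial>lborel)"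
    by (intro nn_integral_cmult lborel.measurable_emeasure_Pair H)
  also have "\<dots> = ennreal ((m + 1) / m) * emeasure lborel ?H"
    using lborel.emeasure_pair_measure_alt[OF H] unfolding lborel_prod by simp
  finally show ?thesis .
qed

section \<open>The gain factor and the final estimate\<close>

theorem theorem6p3:
  "\<exists>c>0. \<forall>(\<alpha>::real) (\<mu>::real) (m::real) (E :: ((real ^ 'd) \<times> real) set) F.
     0 < \<alpha> \<longrightarrow> \<alpha> < 2 \<longrightarrow> 0 < \<mu> \<longrightarrow> \<mu> < 1 \<longrightarrow> 0 < m \<longrightarrow>
     E \<in> sets lebesgue \<longrightarrow> F \<in> sets lebesgue \<longrightarrow>
     E \<subseteq> F \<longrightarrow> F \<subseteq> ball 0 (1/2) \<times> UNIV \<longrightarrow>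
     (\<forall>p\<in>F. \<exists>r y s. 0 < r \<and> cyl \<alpha> r y s \<subseteq> ball 0 1 \<times> UNIV \<and> p \<in> cyl \<alpha> r y s \<and>
        emeasure lebesgue (E \<inter> cyl \<alpha> r y s) \<le> ennreal (1 - \<mu>) * emeasure lebesgue (cyl \<alpha> r y s)) \<longrightarrow>
     (\<forall>r y s. 0 < r \<longrightarrow> cyl \<alpha> r y s \<subseteq> ball 0 1 \<times> UNIV \<longrightarrow>
        emeasure lebesgue (E \<inter> cyl \<alpha> r y s) > ennreal (1 - \<mu>) * emeasure lebesgue (cyl \<alpha> r y s) \<longrightarrow>
        stacked_cyl \<alpha> m r y s \<subseteq> F) \<longrightarrow>
     emeasure lebesgue E \<le> ennreal ((m + 1) / m * (1 - c * \<mu>)) * emeasure lebesgue F"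
proof (intro exI conjI allI impI)
  \<comment> \<open>\<open>C\<close> is the enlargement factor of the covering, so
    \<open>cyl_cover\<close> with density bound \<open>1 - \<mu> / 2\<close> has constant
    \<open>2 * C / \<mu>\<close>. The choice of \<open>c\<close> ensures
    \<open>1 \<le> (1 - c * \<mu>) * (1 + \<mu> / (2 * C))\<close>.\<close>
  define C :: real where "C = 10 * 5 ^ CARD('d)"
  define c where "c = 1 / (2 * C + 1)"
  have C: "0 < C" by (simp add: C_def)
  then show "0 < c" by (simp add: c_def)
  fix \<alpha> \<mu> m :: real and E F :: "((real ^ 'd) \<times> real) set"
  assume \<alpha>: "0 < \<alpha>" "\<alpha> < 2" and \<mu>: "0 < \<mu>" "\<mu> < 1" and m: "0 < m"
    and E: "E \<in> sets lebesgue" and F: "F \<in> sets lebesgue" and EF: "E \<subseteq> F"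
    and "F \<subseteq> ball 0 (1/2) \<times> UNIV"
    and sparse: "\<forall>p\<in>F. \<exists>r y s. 0 < r \<and> cyl \<alpha> r y s \<subseteq> ball 0 1 \<times> UNIV \<and> p \<in> cyl \<alpha> r y s \<and>
        emeasure lebesgue (E \<inter> cyl \<alpha> r y s) \<le> ennreal (1 - \<mu>) * emeasure lebesgue (cyl \<alpha> r y s)"
    and stacked: "\<forall>r y s. 0 < r \<longrightarrow> cyl \<alpha> r y s \<subseteq> ball 0 1 \<times> UNIV \<longrightarrow>
        ennreal (1 - \<mu>) * emeasure lebesgue (cyl \<alpha> r y s) < emeasure lebesgue (E \<inter> cyl \<alpha> r y s) \<longrightarrow>
        stacked_cyl \<alpha> m r y s \<subseteq> F"
  define N where "N = {p\<in>E. \<forall>\<epsilon>>0. \<exists>r y s. 0 < r \<and> r < \<epsilon> \<and> p \<in> cyl \<alpha> r y s \<and>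
    emeasure lebesgue (E \<inter> cyl \<alpha> r y s) \<le> ennreal (1 - \<mu>) * emeasure lebesgue (cyl \<alpha> r y s)}"
  define K where "K = {(r, y, s). 0 < r \<and> cyl \<alpha> r y s \<subseteq> ball 0 1 \<times> UNIV \<and>
    ennreal (1 - \<mu>) * emeasure lebesgue (cyl \<alpha> r y s) < emeasure lebesgue (E \<inter> cyl \<alpha> r (y :: real ^ 'd) s)}"
  \<comment> \<open>Each heavy cylinder is merged with its stacked one into a single open box, which
    also contains the top time \<open>s\<close>.\<close>
  define G where "G = (\<Union>(r, y, s)\<in>K. ball y r \<times> {s - r powr \<alpha> <..< s + m * r powr \<alpha>})"
  define H where "H = (\<Union>(r, y, s)\<in>K. stacked_cyl \<alpha> m r y s)"
  have N: "N \<in> null_sets lebesgue"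
    by (rule null_sets_of_small_density[OF \<alpha> E, of N "1 - \<mu>"]) (use \<mu> in \<open>auto simp: N_def\<close>)
  have "open G" "open H"
    by (auto simp: G_def H_def stacked_cyl_def intro!: open_Times)
  then have GH: "G \<in> sets borel" "H \<in> sets borel" "G \<in> sets lebesgue" "H \<in> sets lebesgue" by auto
  have crit: "\<exists>r y s. 0 < r \<and> r \<le> 1 \<and> p \<in> cyl \<alpha> r y s \<and> cyl \<alpha> r y s \<subseteq> G \<and>
      emeasure lebesgue (E \<inter> cyl \<alpha> r y s) \<le> ennreal (1 - \<mu> / 2) * emeasure lebesgue (cyl \<alpha> r y s)"
    if p: "p \<in> E - N" for p
  proof -
    obtain \<epsilon> where \<epsilon>: "0 < \<epsilon>" "\<And>r y s. 0 < r \<Longrightarrow> r < \<epsilon> \<Longrightarrow> p \<in> cyl \<alpha> r y s \<Longrightarrow>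
        ennreal (1 - \<mu>) * emeasure lebesgue (cyl \<alpha> r y s) < emeasure lebesgue (E \<inter> cyl \<alpha> r y s)"
      using p unfolding N_def by (auto simp: not_le)
    obtain r0 y0 s0 where "0 < r0" "cyl \<alpha> r0 y0 s0 \<subseteq> ball 0 1 \<times> UNIV" "p \<in> cyl \<alpha> r0 y0 s0"
      "emeasure lebesgue (E \<inter> cyl \<alpha> r0 y0 s0) \<le> ennreal (1 - \<mu>) * emeasure lebesgue (cyl \<alpha> r0 y0 s0)"
      using sparse p EF by blast
    then obtain r y s where Q: "0 < r" "p \<in> cyl \<alpha> r y s" "cyl \<alpha> r y s \<subseteq> ball 0 1 \<times> UNIV"
      "ennreal (1 - \<mu>) * emeasure lebesgue (cyl \<alpha> r y s) < emeasure lebesgue (E \<inter> cyl \<alpha> r y s)"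
      "emeasure lebesgue (E \<inter> cyl \<alpha> r y s) \<le> ennreal (1 - \<mu> / 2) * emeasure lebesgue (cyl \<alpha> r y s)"
      using critical_cylinder[OF \<alpha> \<mu> E _ _ _ _ \<epsilon>, of r0 y0 s0 "ball 0 1 \<times> UNIV"] by blast
    \<comment> \<open>A cylinder over the unit ball has radius at most 1, the bound that the Vitali
      selection uses.\<close>
    have "ball y r \<subseteq> ball 0 1"
      using Q(1,3) by (auto simp: cyl_def times_subset_iff)
    then have "norm y + r \<le> 1"
      using Q(1) by (simp add: ball_subset_ball_iff)
    then have "r \<le> 1"
      using norm_ge_zero[of y] by linarith
    moreover have "0 < m * r powr \<alpha>"
      using m Q(1) by simp
    then have "b < s + m * r powr \<alpha>" if "b \<le> s" for b
      using that by linarith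
    then have "cyl \<alpha> r y s \<subseteq> ball y r \<times> {s - r powr \<alpha> <..< s + m * r powr \<alpha>}"
      by (auto simp: cyl_def)
    then have "cyl \<alpha> r y s \<subseteq> G"
      using Q unfolding G_def K_def by blast
    ultimately show ?thesis using Q by blast
  qed
  obtain W where W: "W \<in> sets lebesgue" "E - N \<subseteq> W"
    "emeasure lebesgue W \<le> ennreal (10 * 5 ^ CARD('d) / (1 - (1 - \<mu> / 2))) * emeasure lebesgue (G - E)"
  proof (rule cyl_cover[where A = "E - N", OF \<alpha> E GH(3)])
    show "0 \<le> 1 - \<mu> / 2" "1 - \<mu> / 2 < 1" using \<mu> by auto
  qed (erule crit, rule that)
  have eN: "emeasure lebesgue (E - N) = emeasure lebesgue E"
    using E N by (simp add: emeasure_Diff_null_set)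
  have "emeasure lebesgue E \<le> emeasure lebesgue W"
    unfolding eN[symmetric] using W by (intro emeasure_mono)
  also note W(3)
  also have "10 * 5 ^ CARD('d) / (1 - (1 - \<mu> / 2)) = 2 * C / \<mu>"
    by (simp add: C_def)
  finally have E1: "emeasure lebesgue E \<le> ennreal (2 * C / \<mu>) * emeasure lebesgue (G - E)" .
  have "E - N \<subseteq> G" using crit by blast
  \<comment> \<open>\<open>E - N\<close> and \<open>G - E\<close> are disjoint subsets of
    \<open>G\<close>, so adding the covering bound to the measure of \<open>E\<close> produces the
    gain \<open>1 + \<mu> / (2 * C)\<close>.\<close>
  have "ennreal (1 + \<mu> / (2 * C)) * emeasure lebesgue E
      = emeasure lebesgue E + ennreal (\<mu> / (2 * C)) * emeasure lebesgue E"
    using \<mu> C by (simp add: ennreal_plus distrib_right)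
  also have "\<dots> \<le> emeasure lebesgue E + ennreal (\<mu> / (2 * C)) * (ennreal (2 * C / \<mu>) * emeasure lebesgue (G - E))"
    using E1 by (intro add_left_mono mult_left_mono) auto
  also have "ennreal (\<mu> / (2 * C)) * (ennreal (2 * C / \<mu>) * emeasure lebesgue (G - E)) = emeasure lebesgue (G - E)"
    using \<mu> C by (simp add: mult.assoc[symmetric] ennreal_mult[symmetric])
  also have "emeasure lebesgue E + emeasure lebesgue (G - E) = emeasure lebesgue (E - N) + emeasure lebesgue (G - E)"
    by (simp add: eN)
  also have "\<dots> = emeasure lebesgue ((E - N) \<union> (G - E))"
    using E N GH by (intro plus_emeasure) auto
  also have "\<dots> \<le> emeasure lebesgue G"
    using \<open>E - N \<subseteq> G\<close> GH by (intro emeasure_mono) auto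
  also have "\<dots> = emeasure lborel G" using GH by (simp add: emeasure_completion)
  also have "\<dots> \<le> ennreal ((m + 1) / m) * emeasure lborel H"
    unfolding G_def H_def by (rule emeasure_delayed_union[OF m]) (auto simp: K_def)
  also have "emeasure lborel H = emeasure lebesgue H" using GH by (simp add: emeasure_completion)
  also have "ennreal ((m + 1) / m) * emeasure lebesgue H \<le> ennreal ((m + 1) / m) * emeasure lebesgue F"
  proof (intro mult_left_mono emeasure_mono F)
    show "H \<subseteq> F" using stacked by (auto simp: H_def K_def)
  qed simp
  finally have main: "ennreal (1 + \<mu> / (2 * C)) * emeasure lebesgue E \<le> ennreal ((m + 1) / m) * emeasure lebesgue F" .
  \<comment> \<open>\<open>ennreal\<close> sends negative reals to 0, so positivity is settled
    before products are split.\<close>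
  have c\<mu>: "0 < 1 - c * \<mu>"
  proof -
    have "c * \<mu> \<le> 1 * \<mu>" using C \<mu> by (intro mult_right_mono) (auto simp: c_def)
    then show ?thesis using \<mu> by linarith
  qed
  \<comment> \<open>With denominators cleared, the two sides of the inequality that governs
    \<open>c\<close> differ by exactly \<open>\<mu> * (1 - \<mu>)\<close>.\<close>
  have "0 \<le> \<mu> * (1 - \<mu>)"
    using \<mu> by simp
  then have "(2 * C + 1) * (2 * C) \<le> (2 * C + 1 - \<mu>) * (2 * C + \<mu>)"
    by (simp add: algebra_simps)
  then have "1 \<le> ((2 * C + 1 - \<mu>) * (2 * C + \<mu>)) / ((2 * C + 1) * (2 * C))"
    using C by (subst le_divide_eq_1_pos) auto
  also have "\<dots> = ((2 * C + 1 - \<mu>) / (2 * C + 1)) * ((2 * C + \<mu>) / (2 * C))"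
    by (rule times_divide_times_eq[symmetric])
  also have "(2 * C + 1 - \<mu>) / (2 * C + 1) = 1 - c * \<mu>"
    using C by (simp add: c_def field_simps)
  also have "(2 * C + \<mu>) / (2 * C) = 1 + \<mu> / (2 * C)"
    using C by (simp add: field_simps)
  finally have "1 \<le> (1 - c * \<mu>) * (1 + \<mu> / (2 * C))" .
  then have "1 \<le> ennreal ((1 - c * \<mu>) * (1 + \<mu> / (2 * C)))"
    by (simp only: ennreal_ge_1)
  \<comment> \<open>Multiplying by a factor of at least 1, in place of dividing \<open>main\<close>,
    also covers infinite measures.\<close>
  then have "emeasure lebesgue E \<le> ennreal ((1 - c * \<mu>) * (1 + \<mu> / (2 * C))) * emeasure lebesgue E"
    using mult_right_mono[of 1 _ "emeasure lebesgue E"] by simp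
  also have "\<dots> = ennreal (1 - c * \<mu>) * (ennreal (1 + \<mu> / (2 * C)) * emeasure lebesgue E)"
    using c\<mu> C \<mu> by (simp add: ennreal_mult mult.assoc)
  also have "\<dots> \<le> ennreal (1 - c * \<mu>) * (ennreal ((m + 1) / m) * emeasure lebesgue F)"
    using main by (rule mult_left_mono) simp
  also have "\<dots> = ennreal ((m + 1) / m * (1 - c * \<mu>)) * emeasure lebesgue F"
    using c\<mu> m by (simp add: mult.assoc[symmetric] ennreal_mult[symmetric] mult.commute[of "1 - c * \<mu>"])
  finally show "emeasure lebesgue E \<le> ennreal ((m + 1) / m * (1 - c * \<mu>)) * emeasure lebesgue F" .
qed

end
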